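(* Let $\mathbf x$ be a set of indeterminates, $\lambda,q$ further indeterminates, and $r\ge1$. Let $f(t)=\sum_{n\ge1}f_n\frac{t^n}{n!}$ be a formal power series with $f(0)=0$, $f'(0)\ne0$, with compositional inverse $\overline f$, and suppose $1/\overline f'(t)=\varphi(t)\phi(t)$ where $\varphi$ and $\phi$ are both $\mathbf x$-Pólya frequency functions of order $r$. Let $[R_{n,k}]_{n,k}$ be the exponential Riordan array $(\varphi(f(t))e^{\lambda f(t)},f(t))$, $R_n(q)=\sum_kR_{n,k}q^k$, $R_n^*(q)=q^nR_n(1/q)$, and define $T_n(\lambda)$ by $\varphi(f(t))e^{\lambda f(t)}=\sum_nT_n(\lambda)\frac{t^n}{n!}$, $T_n^*(\lambda)=\lambda^nT_n(1/\lambda)$. Then: (i) $[R_{n,k}]_{n,k}$ is coefficientwise totally positive of order $r$ in $(\lambda,\mathbf x)$; (ii) $(R_n(q))_{n\ge0}$ and $(R_n^*(q))_{n\ge0}$ are coefficientwise Hankel-totally positive of order $r$ in $(q,\lambda,\mathbf x)$; (iii) $(T_n(\lambda))_{n\ge0}$ and $(T_n^*(\lambda))_{n\ge0}$ are coefficientwise Hankel-totally positive of order $r$ in $(\lambda,\mathbf x)$; (iv) $(f_{n+1})_{n\ge0}$ is coefficientwise Hankel-totally positive of order $r$ in $\mathbf x$.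
   Context: The exponential Riordan array $(g(t),f(t))$ (with $g(0)\ne0$, $f(0)=0$, $f'(0)\ne0$) is the lower-triangular matrix with entries $R_{n,k}=\frac{n!}{k!}[t^n]g(t)f(t)^k$. A power series $h(t)=\sum_nh_nt^n$ with $h_n\in\mathbb R[\mathbf x]$ is an $\mathbf x$-Pólya frequency function of order $r$ if its Toeplitz matrix $[h_{i-j}]_{i,j\ge0}$ has all minors of size $\le r$ polynomials in $\mathbf x$ with nonnegative coefficients. A matrix is coefficientwise totally positive of order $r$ if all minors of size $\le r$ are polynomials with nonnegative coefficients; a sequence $(a_n)$ is coefficientwise Hankel-totally positive of order $r$ if $[a_{i+j}]$ is. *)

theory Defs
  imports
    "HOL-Library.Poly_Mapping"
    "HOL-Computational_Algebra.Formal_Power_Series"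
    "HOL-Computational_Algebra.Fraction_Field"
    "HOL-Computational_Algebra.Normalized_Fraction"
    "Jordan_Normal_Form.Determinant"
begin

text \<open>
  Polynomials with real coefficients are finitely supported functions from monomials
  (finitely supported exponent vectors) to the reals.  The indeterminates are the elements of
  a type; for a set \<open>X\<close> of them, \<open>polys X\<close> is the polynomial ring in the indeterminates \<open>X\<close>.
  All formal power series have coefficients in the field of rational functions, in which
  factorials are invertible and a series with \<open>f(0) = 0\<close>, \<open>f'(0) \<noteq> 0\<close> has a compositional
  inverse even if the polynomial \<open>f'(0)\<close> is not constant.  The order on the type of
  indeterminates serves only to obtain the library's integral domain instance.
\<close>

type_synonym 'v mpoly = "('v \<Rightarrow>\<^sub>0 nat) \<Rightarrow>\<^sub>0 real"

type_synonym 'v ratfun = "'v mpoly fract"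

instance fract :: ("{idom, ring_char_0}") field_char_0
proof
  show "inj (of_nat :: nat \<Rightarrow> 'a fract)"
    by (rule injI) (simp add: Fract_of_nat_eq[symmetric] eq_fract)
qed

definition indet :: "'v::linorder \<Rightarrow> 'v ratfun" where
  "indet v = to_fract (Poly_Mapping.single (Poly_Mapping.single v 1) 1)"

definition polys :: "'v::linorder set \<Rightarrow> 'v ratfun set" where
  "polys X = to_fract ` {p. \<forall>m \<in> Poly_Mapping.keys p. Poly_Mapping.keys m \<subseteq> X}"

definition nonneg_polys :: "'v::linorder set \<Rightarrow> 'v ratfun set" where
  "nonneg_polys X = to_fract `
     {p. (\<forall>m \<in> Poly_Mapping.keys p. Poly_Mapping.keys m \<subseteq> X)
        \<and> (\<forall>m. Poly_Mapping.lookup p m \<ge> 0)}"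

definition cw_totally_positive ::
    "'v::linorder set \<Rightarrow> nat \<Rightarrow> (nat \<Rightarrow> nat \<Rightarrow> 'v ratfun) \<Rightarrow> bool" where
  "cw_totally_positive X r M \<longleftrightarrow>
     (\<forall>k \<le> r. \<forall>I J. strict_mono_on {..<k} I \<longrightarrow> strict_mono_on {..<k} J \<longrightarrow>
        det (mat k k (\<lambda>(i, j). M (I i) (J j))) \<in> nonneg_polys X)"

definition cw_hankel_totally_positive ::
    "'v::linorder set \<Rightarrow> nat \<Rightarrow> (nat \<Rightarrow> 'v ratfun) \<Rightarrow> bool" where
  "cw_hankel_totally_positive X r a \<longleftrightarrow> cw_totally_positive X r (\<lambda>i j. a (i + j))"

definition toeplitz :: "'a::zero fps \<Rightarrow> nat \<Rightarrow> nat \<Rightarrow> 'a" where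
  "toeplitz h i j = (if j \<le> i then fps_nth h (i - j) else 0)"

definition polya_frequency :: "'v::linorder set \<Rightarrow> nat \<Rightarrow> 'v ratfun fps \<Rightarrow> bool" where
  "polya_frequency X r h \<longleftrightarrow>
     (\<forall>n. fps_nth h n \<in> polys X) \<and> cw_totally_positive X r (toeplitz h)"

definition exp_riordan :: "'a::field_char_0 fps \<Rightarrow> 'a fps \<Rightarrow> nat \<Rightarrow> nat \<Rightarrow> 'a" where
  "exp_riordan g f n k = fact n / fact k * fps_nth (g * f ^ k) n"

definition egf_coeff :: "'a::field_char_0 fps \<Rightarrow> nat \<Rightarrow> 'a" where
  "egf_coeff h n = fact n * fps_nth h n"

text \<open>
  A sequence of polynomials \<open>P\<^sub>n(z)\<close> in a distinguished indeterminate \<open>z\<close> is given as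
  a function of the value substituted for \<open>z\<close>, so that the reversed polynomial is obtained by
  substituting \<open>1 / z\<close> in the field of rational functions.
\<close>

definition row_poly :: "(nat \<Rightarrow> nat \<Rightarrow> 'a::field_char_0) \<Rightarrow> nat \<Rightarrow> 'a \<Rightarrow> 'a" where
  "row_poly R n z = (\<Sum>k\<le>n. R n k * z ^ k)"

definition reversed :: "(nat \<Rightarrow> 'a::field_char_0 \<Rightarrow> 'a) \<Rightarrow> nat \<Rightarrow> 'a \<Rightarrow> 'a" where
  "reversed P n z = z ^ n * P n (1 / z)"

end

theory Submission
  imports Defs
begin

text \<open>
  Let \<open>g = \<phi>(f) exp((b / a) f)\<close>.  Since \<open>f' = \<phi>(f) \<psi>(f)\<close>, differentiating \<open>g f\<^sup>k / k!\<close> shows that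
  the array \<open>a\<^sup>n R\<^sub>n\<^sub>,\<^sub>k\<close>, where \<open>R\<close> is the exponential Riordan array of \<open>(g, f)\<close>, is generated by
  the production matrix whose \<open>k\<close>-th column has exponential generating function
  \<open>\<psi> (a d/dt + b) (\<phi> t\<^sup>k / k!)\<close>.  This matrix is a product of three factors: the Toeplitz matrices of
  \<open>\<psi>\<close> and \<open>\<phi>\<close>, rescaled by factorials, and between them the bidiagonal matrix with diagonal \<open>b\<close> and
  superdiagonal \<open>a\<close>.  By Cauchy--Binet it is totally positive of order \<open>r\<close>, hence so are the array
  it generates and the Hankel matrix of the zeroth column of that array.

  Write \<open>T\<^sub>n(b / a)\<close> for \<open>n!\<close> times the coefficient of \<open>t\<^sup>n\<close> in \<open>g\<close>.  As \<open>R\<^sub>n(q) = T\<^sub>n(\<lambda> + q)\<close>, the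
  sequences \<open>T, T\<^sup>*, R, R\<^sup>*\<close> are \<open>a\<^sup>n T\<^sub>n(b / a)\<close> for \<open>(a, b)\<close> equal to \<open>(1, \<lambda>)\<close>, \<open>(\<lambda>, 1)\<close>,
  \<open>(1, \<lambda> + q)\<close>, \<open>(q, q \<lambda> + 1)\<close>.  Replacing \<open>(\<phi>, \<psi>)\<close> by \<open>(\<phi> \<psi>, 1)\<close> and taking \<open>(a, b) = (1, 0)\<close>
  turns \<open>g\<close> into \<open>f'\<close>.
\<close>

subsection \<open>Minors and the Cauchy--Binet formula\<close>

text \<open>\<open>I\<close> and \<open>J\<close> are arbitrary index functions, since the
  Cauchy-Binet expansion passes through selections that are neither increasing nor
  injective.\<close>

definition minor :: "(nat \<Rightarrow> nat \<Rightarrow> 'a::comm_ring_1) \<Rightarrow> nat \<Rightarrow> (nat \<Rightarrow> nat) \<Rightarrow> (nat \<Rightarrow> nat) \<Rightarrow> 'a" where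
  "minor M k I J = det (mat k k (\<lambda>(i, j). M (I i) (J j)))"

lemma minor_cong:
  assumes "\<And>i j. i < k \<Longrightarrow> j < k \<Longrightarrow> M (I i) (J j) = N (I' i) (J' j)"
  shows "minor M k I J = minor N k I' J'"
  unfolding minor_def by (rule arg_cong[where f = det], rule eq_matI) (use assms in auto)

lemma minor_expand:
  "minor M k I J = (\<Sum>p | p permutes {0..<k}. signof p * (\<Prod>i\<in>{0..<k}. M (I i) (J (p i))))"
proof -
  have "(\<Prod>i\<in>{0..<k}. mat k k (\<lambda>(i, j). M (I i) (J j)) $$ (i, p i))
      = (\<Prod>i\<in>{0..<k}. M (I i) (J (p i)))" if "p permutes {0..<k}" for p
    by (rule prod.cong) (use permutes_in_image[OF that] in auto)
  then show ?thesis
    unfolding minor_def by (subst det_def'[of _ k]) (auto intro!: sum.cong)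
qed

lemma minor_0 [simp]: "minor M 0 I J = 1"
  by (simp add: minor_def)

lemma minor_transpose: "minor (\<lambda>i j. M j i) k I J = minor M k J I"
proof -
  have "mat k k (\<lambda>(i, j). M (J j) (I i)) = transpose_mat (mat k k (\<lambda>(i, j). M (J i) (I j)))"
    by (rule eq_matI) auto
  then show ?thesis
    unfolding minor_def by (simp add: det_transpose[of _ k])
qed

lemma minor_scale:
  "minor (\<lambda>i j. u i * v j * M i j) k I J
    = (\<Prod>i<k. u (I i)) * (\<Prod>i<k. v (J i)) * minor M k I J"
proof -
  have "(\<Prod>i\<in>{0..<k}. v (J (p i))) = (\<Prod>i\<in>{0..<k}. v (J i))" if "p permutes {0..<k}" for p
    using prod.permute[OF that, of "\<lambda>i. v (J i)"] by (simp add: o_def)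
  then show ?thesis
    unfolding minor_expand
    by (auto simp: prod.distrib sum_distrib_left mult_ac atLeast0LessThan intro!: sum.cong)
qed

lemma minor_permute_rows:
  assumes "p permutes {0..<k}"
  shows "minor M k (\<lambda>i. I (p i)) J = signof p * minor M k I J"
proof -
  have "mat k k (\<lambda>(i, j). M (I (p i)) (J j))
      = mat k k (\<lambda>(i, j). mat k k (\<lambda>(i, j). M (I i) (J j)) $$ (p i, j))"
    by (rule eq_matI) (use permutes_in_image[OF assms] in auto)
  then show ?thesis
    unfolding minor_def by (simp add: det_permute_rows[OF _ assms])
qed

lemma minor_eq_0_if_rows_equal:
  assumes "i < k" "j < k" "i \<noteq> j" "I i = I j"
  shows "minor M k I J = 0"
  unfolding minor_def
  by (rule det_identical_rows[of _ k i j]) (use assms in \<open>auto intro!: eq_vecI\<close>)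

lemma minor_Suc_row:
  assumes "\<And>j. 1 \<le> j \<Longrightarrow> j \<le> k \<Longrightarrow> M (I 0) (J j) = 0"
  shows "minor M (Suc k) I J = M (I 0) (J 0) * minor M k (\<lambda>i. I (Suc i)) (\<lambda>j. J (Suc j))"
proof -
  let ?A = "mat (Suc k) (Suc k) (\<lambda>(i, j). M (I i) (J j))"
  have del: "mat_delete ?A 0 0 = mat k k (\<lambda>(i, j). M (I (Suc i)) (J (Suc j)))"
    by (rule eq_matI) (auto simp: mat_delete_def)
  have "det ?A = (\<Sum>j<Suc k. ?A $$ (0, j) * cofactor ?A 0 j)"
    by (rule laplace_expansion_row) auto
  also have "\<dots> = ?A $$ (0, 0) * cofactor ?A 0 0"
    unfolding sum.lessThan_Suc_shift by (simp add: assms)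
  finally show ?thesis
    by (simp add: minor_def cofactor_def del)
qed

lemma minor_zero_row:
  assumes "\<And>j. j \<le> k \<Longrightarrow> M (I 0) (J j) = 0"
  shows "minor M (Suc k) I J = 0"
  by (subst minor_Suc_row) (use assms in auto)

lemma minor_zero_col:
  assumes "\<And>i. i \<le> k \<Longrightarrow> M (I i) (J 0) = 0"
  shows "minor M (Suc k) I J = 0"
  using minor_zero_row[of k "\<lambda>i j. M j i" J I] assms by (simp add: minor_transpose[of M])

lemma minor_Suc_col:
  assumes "\<And>i. 1 \<le> i \<Longrightarrow> i \<le> k \<Longrightarrow> M (I i) (J 0) = 0"
  shows "minor M (Suc k) I J = M (I 0) (J 0) * minor M k (\<lambda>i. I (Suc i)) (\<lambda>j. J (Suc j))"
  using minor_Suc_row[of k "\<lambda>i j. M j i" J I] assms by (simp add: minor_transpose[of M])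

text \<open>Multilinearity of the determinant: each row of the product is a combination of rows of
  \<open>B\<close>, and \<open>h\<close> records which row is picked in each place. Fixing
  \<open>h\<close> outside \<open>{0..<k}\<close> keeps the index set finite.\<close>

lemma minor_mult_expand:
  "minor (\<lambda>i j. \<Sum>s<m. A i s * B s j) k I J =
    (\<Sum>h | (\<forall>i\<in>{0..<k}. h i \<in> {..<m}) \<and> (\<forall>i. i \<notin> {0..<k} \<longrightarrow> h i = i).
       (\<Prod>i\<in>{0..<k}. A (I i) (h i)) * minor B k h J)"
proof -
  let ?a = "\<lambda>i s. A (I i) s \<cdot>\<^sub>v vec k (\<lambda>j. B s (J j))"
  have "mat k k (\<lambda>(i, j). \<Sum>s<m. A (I i) s * B s (J j))
      = mat\<^sub>r k k (\<lambda>i. finsum_vec TYPE('a) k (?a i) {..<m})"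
    by (rule eq_matI) (auto simp: index_finsum_vec)
  moreover have "det (mat\<^sub>r k k (\<lambda>i. ?a i (h i)))
      = (\<Prod>i\<in>{0..<k}. A (I i) (h i)) * minor B k h J" for h
  proof -
    have "mat\<^sub>r k k (\<lambda>i. vec k (\<lambda>j. B (h i) (J j))) = mat k k (\<lambda>(i, j). B (h i) (J j))"
      by (rule eq_matI) auto
    then show ?thesis
      unfolding minor_def by (subst det_rows_mul) auto
  qed
  ultimately show ?thesis
    unfolding minor_def[of _ _ I]
    by (simp add: det_linear_rows_sum[of "{..<m}" ?a k])
qed

text \<open>An injective selection with image \<open>U\<close> is a unique permutation followed by
  the increasing enumeration of \<open>U\<close>, so the selections with a given image can be summed
  by the Leibniz formula.\<close>

lemma bij_betw_injections_permutations:
  fixes U :: "nat set"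
  assumes U: "finite U" "card U = k"
  shows "bij_betw (\<lambda>p i. if i < k then enumerate U (p i) else i) {p. p permutes {0..<k}}
    {h. inj_on h {0..<k} \<and> h ` {0..<k} = U \<and> (\<forall>i. i \<notin> {0..<k} \<longrightarrow> h i = i)}"
    (is "bij_betw ?F ?P ?H")
proof -
  have e: "bij_betw (enumerate U) {0..<k} U"
    using finite_bij_enumerate[OF U(1)] U(2) by (simp add: atLeast0LessThan)
  show ?thesis
    unfolding bij_betw_def
  proof (intro conjI subset_antisym subsetI)
    show "inj_on ?F ?P"
    proof (rule inj_onI)
      fix p p' assume pp: "p \<in> ?P" "p' \<in> ?P" and eq: "?F p = ?F p'"
      show "p = p'"
      proof
        fix i show "p i = p' i"
        proof (cases "i < k")
          case True
          then have "enumerate U (p i) = enumerate U (p' i)"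
            using fun_cong[OF eq, of i] by simp
          moreover have "p i \<in> {0..<k}" "p' i \<in> {0..<k}"
            using pp True permutes_in_image[of p "{0..<k}" i] permutes_in_image[of p' "{0..<k}" i]
            by auto
          ultimately show ?thesis
            using e by (auto simp: bij_betw_def dest: inj_onD)
        next
          case False
          then show ?thesis using pp by (auto simp: permutes_def)
        qed
      qed
    qed
  next
    fix h assume "h \<in> ?F ` ?P"
    then obtain p where p: "p permutes {0..<k}" and h: "h = ?F p" by auto
    have "bij_betw (\<lambda>i. enumerate U (p i)) {0..<k} U"
      using bij_betw_trans[OF permutes_imp_bij[OF p] e] by (simp add: o_def)
    then have "bij_betw h {0..<k} U"
      by (rule bij_betw_cong[THEN iffD1, rotated]) (simp add: h)
    then show "h \<in> ?H" by (auto simp: bij_betw_def h)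
  next
    fix h assume h: "h \<in> ?H"
    define p where "p i = (if i < k then inv_into {0..<k} (enumerate U) (h i) else i)" for i
    have "bij_betw (\<lambda>i. inv_into {0..<k} (enumerate U) (h i)) {0..<k} {0..<k}"
      using bij_betw_trans[of h "{0..<k}" U, OF _ bij_betw_inv_into[OF e]] h
      by (auto simp: bij_betw_def o_def)
    then have "bij_betw p {0..<k} {0..<k}"
      by (rule bij_betw_cong[THEN iffD1, rotated]) (simp add: p_def)
    then have "p permutes {0..<k}"
      by (rule bij_imp_permutes) (auto simp: p_def)
    moreover have "?F p = h"
    proof
      fix i show "?F p i = h i"
      proof (cases "i < k")
        case True
        then have "h i \<in> U" using h by auto
        then show ?thesis using True bij_betw_inv_into_right[OF e] by (simp add: p_def)
      next
        case False
        then show ?thesis using h by auto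
      qed
    qed
    ultimately show "h \<in> ?F ` ?P" by blast
  qed
qed

text \<open>In the multilinear expansion a repeated row of \<open>B\<close> kills the term; the
  remaining terms are grouped by their image \<open>U\<close>. Sorting the rows of \<open>B\<close>
  produces the sign that turns the products of entries of \<open>A\<close> into a minor.\<close>

theorem cauchy_binet:
  "minor (\<lambda>i j. \<Sum>s<m. A i s * B s j) k I J =
    (\<Sum>U | U \<subseteq> {..<m} \<and> card U = k. minor A k I (enumerate U) * minor B k (enumerate U) J)"
proof -
  let ?F = "{h. (\<forall>i\<in>{0..<k}. h i \<in> {..<m}) \<and> (\<forall>i. i \<notin> {0..<k} \<longrightarrow> h i = i)}"
  let ?K = "{h \<in> ?F. inj_on h {0..<k}}"
  let ?T = "\<lambda>h. (\<Prod>i\<in>{0..<k}. A (I i) (h i)) * minor B k h J"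
  let ?W = "{U. U \<subseteq> {..<m} \<and> card U = k}"
  have fin: "finite ?F" by (rule finite_bounded_functions) auto
  have "?T h = 0" if "\<not> inj_on h {0..<k}" for h
  proof -
    from that obtain i j where "i < k" "j < k" "i \<noteq> j" "h i = h j"
      by (auto simp: inj_on_def)
    then have "minor B k h J = 0" by (rule minor_eq_0_if_rows_equal)
    then show ?thesis by simp
  qed
  then have "(\<Sum>h\<in>?F. ?T h) = (\<Sum>h\<in>?K. ?T h)"
    by (intro sum.mono_neutral_right fin) auto
  also have "\<dots> = (\<Sum>U\<in>?W. \<Sum>h | h \<in> ?K \<and> h ` {0..<k} = U. ?T h)"
  proof (rule sum.group[symmetric])
    show "finite ?K" by (rule finite_subset[OF _ fin]) auto
  qed (auto simp: card_image)
  also have "\<dots> = (\<Sum>U\<in>?W. minor A k I (enumerate U) * minor B k (enumerate U) J)"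
  proof (rule sum.cong[OF refl])
    fix U assume "U \<in> ?W"
    then have U: "U \<subseteq> {..<m}" "card U = k" "finite U" by (auto intro: finite_subset)
    let ?f = "\<lambda>p i. if i < k then enumerate U (p i) else i"
    have "{h \<in> ?K. h ` {0..<k} = U}
        = {h. inj_on h {0..<k} \<and> h ` {0..<k} = U \<and> (\<forall>i. i \<notin> {0..<k} \<longrightarrow> h i = i)}"
      using U(1) by auto
    then have "(\<Sum>h | h \<in> ?K \<and> h ` {0..<k} = U. ?T h) = (\<Sum>p | p permutes {0..<k}. ?T (?f p))"
      using sum.reindex_bij_betw[OF bij_betw_injections_permutations[OF U(3,2)], of ?T] by simp
    also have "\<dots> = (\<Sum>p | p permutes {0..<k}.
        (signof p * (\<Prod>i\<in>{0..<k}. A (I i) (enumerate U (p i)))) * minor B k (enumerate U) J)"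
    proof (rule sum.cong[OF refl])
      fix p assume "p \<in> {p. p permutes {0..<k}}"
      then have p: "p permutes {0..<k}" by simp
      have "minor B k (?f p) J = minor B k (\<lambda>i. enumerate U (p i)) J"
        by (rule minor_cong) simp
      then show "?T (?f p) =
        (signof p * (\<Prod>i\<in>{0..<k}. A (I i) (enumerate U (p i)))) * minor B k (enumerate U) J"
        by (simp add: minor_permute_rows[OF p])
    qed
    finally show "(\<Sum>h | h \<in> ?K \<and> h ` {0..<k} = U. ?T h)
        = minor A k I (enumerate U) * minor B k (enumerate U) J"
      by (simp add: minor_expand[of A] sum_distrib_right)
  qed
  finally show ?thesis by (simp add: minor_mult_expand)
qed

subsection \<open>Total positivity and production matrices\<close>

definition totally_positive_in ::
    "'a::comm_ring_1 set \<Rightarrow> nat \<Rightarrow> (nat \<Rightarrow> nat \<Rightarrow> 'a) \<Rightarrow> bool" where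
  "totally_positive_in S r M \<longleftrightarrow>
     (\<forall>k \<le> r. \<forall>I J. strict_mono_on {..<k} I \<longrightarrow> strict_mono_on {..<k} J \<longrightarrow> minor M k I J \<in> S)"

lemma totally_positive_inD:
  "totally_positive_in S r M \<Longrightarrow> k \<le> r \<Longrightarrow> strict_mono_on {..<k} I \<Longrightarrow> strict_mono_on {..<k} J
    \<Longrightarrow> minor M k I J \<in> S"
  by (auto simp: totally_positive_in_def)

lemma totally_positive_in_mono:
  "totally_positive_in S r M \<Longrightarrow> S \<subseteq> S' \<Longrightarrow> totally_positive_in S' r M"
  by (auto simp: totally_positive_in_def)

lemma totally_positive_in_transpose:
  "totally_positive_in S r M \<Longrightarrow> totally_positive_in S r (\<lambda>i j. M j i)"
  by (auto simp: totally_positive_in_def minor_transpose[of M])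

lemma totally_positive_in_entry:
  assumes "totally_positive_in S r M" "r \<ge> 1"
  shows "M i j \<in> S"
proof -
  have "minor M 1 (\<lambda>_. i) (\<lambda>_. j) \<in> S"
    by (rule totally_positive_inD[OF assms]) (auto intro!: strict_mono_onI)
  then show ?thesis
    using minor_Suc_row[of 0 M "\<lambda>_. i" "\<lambda>_. j"] by simp
qed

lemma strict_mono_on_Suc:
  "strict_mono_on {..<Suc k} I \<Longrightarrow> strict_mono_on {..<k} (\<lambda>i. I (Suc i))"
  by (auto intro!: strict_mono_onI dest: strict_mono_onD)

lemma strict_mono_on_0_less:
  fixes I :: "nat \<Rightarrow> nat"
  assumes "strict_mono_on {..<Suc k} I" "1 \<le> i" "i \<le> k"
  shows "I 0 < I i"
  using assms by (auto intro: strict_mono_onD)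

text \<open>An abstraction of \<open>nonneg_polys X\<close>. Reciprocals of naturals are included to
  absorb the factorials in \<open>exp_toeplitz\<close>; for \<open>n = 0\<close> the convention
  \<open>inverse 0 = 0\<close> applies.\<close>

locale positive_semiring =
  fixes S :: "'a::field_char_0 set"
  assumes zero_closed: "0 \<in> S"
    and one_closed: "1 \<in> S"
    and add_closed: "x \<in> S \<Longrightarrow> y \<in> S \<Longrightarrow> x + y \<in> S"
    and mult_closed: "x \<in> S \<Longrightarrow> y \<in> S \<Longrightarrow> x * y \<in> S"
    and inverse_of_nat_closed: "inverse (of_nat n) \<in> S"
begin

lemma sum_closed: "(\<And>i. i \<in> A \<Longrightarrow> u i \<in> S) \<Longrightarrow> sum u A \<in> S"
  by (induction A rule: infinite_finite_induct) (auto intro: zero_closed add_closed)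

lemma prod_closed: "(\<And>i. i \<in> A \<Longrightarrow> u i \<in> S) \<Longrightarrow> prod u A \<in> S"
  by (induction A rule: infinite_finite_induct) (auto intro: one_closed mult_closed)

lemma of_nat_closed: "of_nat n \<in> S"
  by (induction n) (auto intro: zero_closed one_closed add_closed)

text \<open>The rows \<open>I\<close> of \<open>C\<close> may come from different rows
  \<open>I'\<close> of \<open>A\<close>, as happens when a recurrence expresses row
  \<open>n + 1\<close> by row \<open>n\<close>. Positivity of \<open>A\<close> is asked for these
  rows alone, so that an induction hypothesis can supply it.\<close>

lemma minor_mult_closed:
  assumes C: "\<And>i j. i < k \<Longrightarrow> j < k \<Longrightarrow> C (I i) (J j) = (\<Sum>s<m. A (I' i) s * B s (J j))"
    and A: "\<And>K. strict_mono_on {..<k} K \<Longrightarrow> minor A k I' K \<in> S"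
    and B: "\<And>K. strict_mono_on {..<k} K \<Longrightarrow> minor B k K J \<in> S"
  shows "minor C k I J \<in> S"
proof -
  have "strict_mono_on {..<k} (enumerate U)" if "U \<subseteq> {..<m}" "card U = k" for U :: "nat set"
    using that finite_subset[OF that(1)]
    by (auto intro!: strict_mono_onI finite_enumerate_mono)
  then have "minor (\<lambda>i j. \<Sum>s<m. A i s * B s j) k I' J \<in> S"
    unfolding cauchy_binet by (intro sum_closed mult_closed A B) auto
  also have "minor (\<lambda>i j. \<Sum>s<m. A i s * B s j) k I' J = minor C k I J"
    by (rule minor_cong) (simp add: C)
  finally show ?thesis .
qed

text \<open>A minor sees finitely many entries, so the infinite product may be truncated at any
  \<open>m\<close> that is correct on the corner of size \<open>N\<close>.\<close>

lemma totally_positive_in_mult: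
  assumes A: "totally_positive_in S r A" and B: "totally_positive_in S r B"
    and C: "\<And>N. \<exists>m. \<forall>i<N. \<forall>j<N. C i j = (\<Sum>s<m. A i s * B s j)"
  shows "totally_positive_in S r C"
  unfolding totally_positive_in_def
proof (intro allI impI)
  fix k and I J :: "nat \<Rightarrow> nat"
  assume k: "k \<le> r" and I: "strict_mono_on {..<k} I" and J: "strict_mono_on {..<k} J"
  define N where "N = Suc (\<Sum>i<k. I i + J i)"
  have N: "I i < N" "J i < N" if "i < k" for i
    using member_le_sum[of i "{..<k}" "\<lambda>i. I i + J i"] that by (auto simp: N_def)
  obtain m where "\<forall>i<N. \<forall>j<N. C i j = (\<Sum>s<m. A i s * B s j)" using C by blast
  then have "C (I i) (J j) = (\<Sum>s<m. A (I i) s * B s (J j))" if "i < k" "j < k" for i j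
    using N that by blast
  then show "minor C k I J \<in> S"
    by (rule minor_mult_closed)
       (auto intro: totally_positive_inD[OF A k I] totally_positive_inD[OF B k _ J])
qed

lemma totally_positive_in_scale:
  assumes M: "totally_positive_in S r M" and "\<And>i. u i \<in> S" "\<And>i. v i \<in> S"
  shows "totally_positive_in S r (\<lambda>i j. u i * v j * M i j)"
  unfolding totally_positive_in_def minor_scale
  by (intro allI impI mult_closed prod_closed totally_positive_inD[OF M] assms)

text \<open>Compare the first selected column with the first selected row. On the diagonal the first
  column of the minor is \<open>b\<close> followed by zeros; on the superdiagonal the first row is
  \<open>a\<close> followed by zeros; elsewhere the first column or the first row vanishes.\<close>

lemma totally_positive_in_bidiagonal:
  assumes "a \<in> S" "b \<in> S"
  shows "totally_positive_in S r (\<lambda>i j. if j = i then b else if j = Suc i then a else 0)"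
    (is "totally_positive_in S r ?B")
proof -
  have "minor ?B k I J \<in> S" if "strict_mono_on {..<k} I" "strict_mono_on {..<k} J" for k I J
    using that
  proof (induction k arbitrary: I J)
    case 0
    then show ?case by (simp add: one_closed)
  next
    case (Suc k)
    note I = strict_mono_on_0_less[OF Suc.prems(1)] and J = strict_mono_on_0_less[OF Suc.prems(2)]
    have rest: "minor ?B k (\<lambda>i. I (Suc i)) (\<lambda>j. J (Suc j)) \<in> S"
      by (rule Suc.IH; rule strict_mono_on_Suc; rule Suc.prems)
    consider "J 0 < I 0" | "J 0 = I 0" | "J 0 = Suc (I 0)" | "J 0 > Suc (I 0)" by linarith
    then show ?case
    proof cases
      case 1
      have "I 0 \<le> I i" if "i \<le> k" for i using I[of i] that by (cases "i = 0") auto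
      with 1 have "minor ?B (Suc k) I J = 0" by (intro minor_zero_col) fastforce
      then show ?thesis by (simp add: zero_closed)
    next
      case 2
      with I have "minor ?B (Suc k) I J = ?B (I 0) (J 0) * minor ?B k (\<lambda>i. I (Suc i)) (\<lambda>j. J (Suc j))"
        by (intro minor_Suc_col) fastforce
      then show ?thesis using 2 assms rest by (auto intro: mult_closed)
    next
      case 3
      with J have "minor ?B (Suc k) I J = ?B (I 0) (J 0) * minor ?B k (\<lambda>i. I (Suc i)) (\<lambda>j. J (Suc j))"
        by (intro minor_Suc_row) fastforce
      then show ?thesis using 3 assms rest by (auto intro: mult_closed)
    next
      case 4
      have "J 0 \<le> J i" if "i \<le> k" for i using J[of i] that by (cases "i = 0") auto
      with 4 have "minor ?B (Suc k) I J = 0" by (intro minor_zero_row) fastforce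
      then show ?thesis by (simp add: zero_closed)
    qed
  qed
  then show ?thesis by (simp add: totally_positive_in_def)
qed

text \<open>Informally, row \<open>n\<close> of \<open>U\<close> is \<open>c\<close> times row 0 of
  the \<open>n\<close>-th power of \<open>P\<close>. If the first selected row is positive, one
  factor \<open>P\<close> is split off and all row indices drop by one; if it is row 0, expansion
  along it lowers \<open>k\<close>. The cutoff \<open>m\<close> may depend on \<open>N\<close>, so
  that the lemma serves both a lower Hessenberg \<open>P\<close> and its transpose.\<close>

lemma totally_positive_in_output:
  assumes P: "totally_positive_in S r P" and c: "c \<in> S"
    and U0: "\<And>j. U 0 j = (if j = 0 then c else 0)"
    and rec: "\<And>N. \<exists>m. \<forall>n<N. \<forall>j<N. U (Suc n) j = (\<Sum>s<m. U n s * P s j)"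
  shows "totally_positive_in S r U"
proof -
  have "minor U k I J \<in> S"
    if "k \<le> r" "strict_mono_on {..<k} I" "strict_mono_on {..<k} J" for k I J
    using that
  proof (induction "k + (\<Sum>i<k. I i)" arbitrary: k I J rule: less_induct)
    case (less k I J)
    show ?case
    proof (cases "k = 0 \<or> I 0 = 0")
      case False
      have pos: "I i > 0" if "i < k" for i
        using False that less.prems(2) by (cases i) (auto dest: strict_mono_onD[of _ I 0 i])
      define N where "N = Suc (\<Sum>i<k. I i + J i)"
      have N: "I i < N" "J i < N" if "i < k" for i
        using member_le_sum[of i "{..<k}" "\<lambda>i. I i + J i"] that by (auto simp: N_def)
      obtain m where m: "\<forall>n<N. \<forall>j<N. U (Suc n) j = (\<Sum>s<m. U n s * P s j)" using rec by blast
      have mono: "strict_mono_on {..<k} (\<lambda>i. I i - 1)"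
        using pos less.prems(2) by (fastforce intro!: strict_mono_onI diff_less_mono dest: strict_mono_onD)
      have smaller: "(\<Sum>i<k. I i - 1) < (\<Sum>i<k. I i)"
        by (rule sum_strict_mono) (use False pos in fastforce)+
      show ?thesis
      proof (rule minor_mult_closed[where m = m and A = U and B = P and I' = "\<lambda>i. I i - 1"])
        fix i j assume ij: "i < k" "j < k"
        then have "U (Suc (I i - 1)) (J j) = (\<Sum>s<m. U (I i - 1) s * P s (J j))"
          using m N by (simp add: less_imp_diff_less)
        then show "U (I i) (J j) = (\<Sum>s<m. U (I i - 1) s * P s (J j))"
          using pos[OF ij(1)] by simp
      next
        fix K :: "nat \<Rightarrow> nat" assume "strict_mono_on {..<k} K"
        then show "minor U k (\<lambda>i. I i - 1) K \<in> S"
          using less.hyps[of k "\<lambda>i. I i - 1" K] smaller mono less.prems by simp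
      next
        fix K :: "nat \<Rightarrow> nat" assume "strict_mono_on {..<k} K"
        then show "minor P k K J \<in> S"
          using totally_positive_inD[OF P] less.prems by blast
      qed
    next
      case True
      show ?thesis
      proof (cases k)
        case 0
        then show ?thesis by (simp add: one_closed)
      next
        case (Suc k')
        with True have I0: "I 0 = 0" by simp
        have "minor U k' (\<lambda>i. I (Suc i)) (\<lambda>j. J (Suc j)) \<in> S"
          using Suc less.prems I0
          by (intro less.hyps strict_mono_on_Suc) (auto simp: sum.lessThan_Suc_shift simp del: sum.lessThan_Suc)
        moreover have "minor U k I J = U 0 (J 0) * minor U k' (\<lambda>i. I (Suc i)) (\<lambda>j. J (Suc j))"
          using strict_mono_on_0_less[of k' J] less.prems
          unfolding Suc by (subst minor_Suc_row) (fastforce simp: I0 U0)+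
        ultimately show ?thesis by (auto simp: U0 c intro: mult_closed zero_closed)
      qed
    qed
  qed
  then show ?thesis by (simp add: totally_positive_in_def)
qed

lemma hankel_totally_positive_in_output:
  assumes P: "totally_positive_in S r P" and c: "c \<in> S"
    and P0: "\<And>i j. j > Suc i \<Longrightarrow> P i j = 0"
    and U0: "\<And>j. U 0 j = (if j = 0 then c else 0)"
    and rec: "\<And>n j. U (Suc n) j = (\<Sum>s\<le>n. U n s * P s j)"
  shows "totally_positive_in S r U" "totally_positive_in S r (\<lambda>i j. U (i + j) 0)"
proof -
  \<comment> \<open>As \<open>P\<close> vanishes beyond its first superdiagonal, \<open>U\<close> is
    lower triangular, and all sums over a row of \<open>U\<close> can share one cutoff.\<close>
  have upper: "U n j = 0" if "j > n" for n j
    using that by (cases n) (auto simp: U0 rec P0 intro!: sum.neutral)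
  have extend: "(\<Sum>s\<le>n. U n s * w s) = (\<Sum>s<m. U n s * w s)" if "n < m" for n m w
    using that by (intro sum.mono_neutral_left) (auto simp: upper)
  show U: "totally_positive_in S r U"
  proof (rule totally_positive_in_output[where c = c, OF P c])
    fix N show "\<exists>m. \<forall>n<N. \<forall>j<N. U (Suc n) j = (\<Sum>s<m. U n s * P s j)"
      by (rule exI[of _ N]) (auto simp: rec extend)
  qed (rule U0)
  \<comment> \<open>In terms of powers, \<open>U n s = c * (P ^ n)\<^sub>0\<^sub>,\<^sub>s\<close> and \<open>V n s = (P ^ n)\<^sub>s\<^sub>,\<^sub>0\<close>, so the Hankel matrix is the
    product of \<open>U\<close> and the transpose of \<open>V\<close>.\<close>
  define V :: "nat \<Rightarrow> nat \<Rightarrow> 'a" where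
    "V = rec_nat (\<lambda>j. if j = 0 then 1 else 0) (\<lambda>_ v j. \<Sum>s\<le>Suc j. P j s * v s)"
  have V0: "V 0 j = (if j = 0 then 1 else 0)" and V_rec: "V (Suc n) j = (\<Sum>s\<le>Suc j. P j s * V n s)" for n j
    by (simp_all add: V_def)
  have V_extend: "V (Suc n) j = (\<Sum>s<m. P j s * V n s)" if "Suc j < m" for n j m
    unfolding V_rec by (rule sum.mono_neutral_left) (use that in \<open>auto simp: P0\<close>)
  have V: "totally_positive_in S r V"
  proof (rule totally_positive_in_output[where c = 1, OF totally_positive_in_transpose[OF P] one_closed])
    \<comment> \<open>Row \<open>j\<close> of \<open>P\<close> reaches column \<open>j + 1\<close>,
      so the cutoff exceeds \<open>N\<close> by one.\<close>
    fix N show "\<exists>m. \<forall>n<N. \<forall>j<N. V (Suc n) j = (\<Sum>s<m. V n s * P j s)"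
      by (rule exI[of _ "Suc N"]) (auto simp: V_extend[of _ "Suc N"] mult.commute)
  qed (rule V0)
  \<comment> \<open>The induction moves one factor \<open>P\<close> at a time from \<open>U\<close>
    to \<open>V\<close>.\<close>
  have split: "U (n + m) 0 = (\<Sum>s\<le>n. U n s * V m s)" for n m
  proof (induction m arbitrary: n)
    case 0
    have "(\<Sum>s\<le>n. U n s * V 0 s) = (\<Sum>s\<le>n. if s = 0 then U n s else 0)"
      by (intro sum.cong) (auto simp: V0)
    also have "\<dots> = U n 0" by simp
    finally show ?case by simp
  next
    case (Suc m)
    have "U (n + Suc m) 0 = (\<Sum>s\<le>Suc n. U (Suc n) s * V m s)"
      using Suc.IH[of "Suc n"] by simp
    also have "\<dots> = (\<Sum>s\<le>Suc n. \<Sum>j\<le>n. U n j * (P j s * V m s))"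
      unfolding rec by (simp only: sum_distrib_right mult.assoc)
    also have "\<dots> = (\<Sum>j\<le>n. U n j * (\<Sum>s\<le>Suc n. P j s * V m s))"
      by (subst sum.swap) (simp only: sum_distrib_left)
    also have "\<dots> = (\<Sum>j\<le>n. U n j * V (Suc m) j)"
      by (rule sum.cong) (auto simp: V_extend[of _ "Suc (Suc n)"] lessThan_Suc_atMost[symmetric]
          simp del: sum.lessThan_Suc sum.atMost_Suc)
    finally show ?case .
  qed
  show "totally_positive_in S r (\<lambda>i j. U (i + j) 0)"
  proof (rule totally_positive_in_mult[OF U totally_positive_in_transpose[OF V]])
    fix N show "\<exists>m. \<forall>i<N. \<forall>j<N. U (i + j) 0 = (\<Sum>s<m. U i s * V j s)"
      by (rule exI[of _ N]) (auto simp: split extend)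
  qed
qed

end

subsection \<open>Exponential Riordan arrays\<close>

unbundle fps_syntax
no_notation vec_index (infixl "$" 100)

text \<open>This is the exponential Riordan array of \<open>(h, fps_X)\<close>, that is,
  multiplication by \<open>h\<close> acting on exponential coefficients.\<close>

definition exp_toeplitz :: "'a::field_char_0 fps \<Rightarrow> nat \<Rightarrow> nat \<Rightarrow> 'a" where
  "exp_toeplitz h n k = fact n / fact k * toeplitz h n k"

lemma egf_coeff_mult:
  "egf_coeff (h * F) n = (\<Sum>s\<le>n. exp_toeplitz h n s * egf_coeff F s)"
proof -
  have "egf_coeff (h * F) n = (\<Sum>s\<le>n. fact n * (F $ s * h $ (n - s)))"
    by (simp add: egf_coeff_def mult.commute[of h] fps_mult_nth sum_distrib_left atLeast0AtMost)
  also have "\<dots> = (\<Sum>s\<le>n. exp_toeplitz h n s * egf_coeff F s)"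
    by (rule sum.cong) (auto simp: exp_toeplitz_def egf_coeff_def toeplitz_def)
  finally show ?thesis .
qed

lemma exp_toeplitz_conv_egf_coeff:
  "exp_toeplitz h n k = egf_coeff (fps_const (inverse (fact k)) * (h * fps_X ^ k)) n"
  by (simp add: exp_toeplitz_def egf_coeff_def toeplitz_def fps_X_power_mult_right_nth
      divide_inverse mult.assoc)

definition production_matrix ::
    "'a::field_char_0 \<Rightarrow> 'a \<Rightarrow> 'a fps \<Rightarrow> 'a fps \<Rightarrow> nat \<Rightarrow> nat \<Rightarrow> 'a" where
  "production_matrix a b \<phi> \<psi> n k =
     (let F = fps_const (inverse (fact k)) * (\<phi> * fps_X ^ k)
      in egf_coeff (\<psi> * (fps_const a * fps_deriv F + fps_const b * F)) n)"

lemma egf_coeff_linear_deriv: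
  "egf_coeff (fps_const a * fps_deriv F + fps_const b * F) n
    = b * egf_coeff F n + a * egf_coeff F (Suc n)"
  by (simp add: egf_coeff_def algebra_simps)

text \<open>On exponential coefficients \<open>d/dt\<close> is the shift, so
  \<open>a d/dt + b\<close> combines rows \<open>s + 1\<close> and \<open>s\<close> of the matrix of
  \<open>\<phi>\<close>; multiplication by \<open>\<psi>\<close> is the outer factor.\<close>

lemma production_matrix_factor:
  "production_matrix a b \<phi> \<psi> n k =
     (\<Sum>s\<le>n. exp_toeplitz \<psi> n s * (b * exp_toeplitz \<phi> s k + a * exp_toeplitz \<phi> (Suc s) k))"
  unfolding production_matrix_def Let_def
  by (subst egf_coeff_mult) (simp only: egf_coeff_linear_deriv exp_toeplitz_conv_egf_coeff[of \<phi>])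

lemma exp_toeplitz_eq_0: "n < k \<Longrightarrow> exp_toeplitz h n k = 0"
  by (simp add: exp_toeplitz_def toeplitz_def)

lemma production_matrix_eq_0: "k > Suc n \<Longrightarrow> production_matrix a b \<phi> \<psi> n k = 0"
  unfolding production_matrix_factor by (intro sum.neutral) (auto simp: exp_toeplitz_eq_0)

lemma (in positive_semiring) totally_positive_in_exp_toeplitz:
  assumes "totally_positive_in S r (toeplitz h)"
  shows "totally_positive_in S r (exp_toeplitz h)"
proof -
  have "exp_toeplitz h = (\<lambda>n k. of_nat (fact n) * inverse (of_nat (fact k)) * toeplitz h n k)"
    by (intro ext) (simp add: exp_toeplitz_def divide_inverse)
  then show ?thesis
    by (simp only:) (intro totally_positive_in_scale assms of_nat_closed inverse_of_nat_closed)
qed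

lemma (in positive_semiring) totally_positive_in_production_matrix:
  assumes \<phi>: "totally_positive_in S r (toeplitz \<phi>)" and \<psi>: "totally_positive_in S r (toeplitz \<psi>)"
    and ab: "a \<in> S" "b \<in> S"
  shows "totally_positive_in S r (production_matrix a b \<phi> \<psi>)"
proof -
  let ?B = "\<lambda>i j. if j = i then b else if j = Suc i then a else 0"
  let ?Q = "\<lambda>s k. b * exp_toeplitz \<phi> s k + a * exp_toeplitz \<phi> (Suc s) k"
  have Q: "totally_positive_in S r ?Q"
  proof (rule totally_positive_in_mult[OF totally_positive_in_bidiagonal[OF ab]
        totally_positive_in_exp_toeplitz[OF \<phi>]])
    fix N
    have "(\<Sum>s<Suc N. ?B i s * exp_toeplitz \<phi> s j) = ?Q i j" if "i < N" for i j
    proof -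
      have "(\<Sum>s<Suc N. ?B i s * exp_toeplitz \<phi> s j) = (\<Sum>s\<in>{i, Suc i}. ?B i s * exp_toeplitz \<phi> s j)"
        using that by (intro sum.mono_neutral_right) auto
      then show ?thesis by simp
    qed
    then show "\<exists>m. \<forall>i<N. \<forall>j<N. ?Q i j = (\<Sum>s<m. ?B i s * exp_toeplitz \<phi> s j)"
      by (intro exI[of _ "Suc N"]) simp
  qed
  show ?thesis
  proof (rule totally_positive_in_mult[OF totally_positive_in_exp_toeplitz[OF \<psi>] Q])
    fix N
    have "production_matrix a b \<phi> \<psi> i j = (\<Sum>s<N. exp_toeplitz \<psi> i s * ?Q s j)" if "i < N" for i j
      unfolding production_matrix_factor using that
      by (intro sum.mono_neutral_left) (auto simp: exp_toeplitz_eq_0)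
    then show "\<exists>m. \<forall>i<N. \<forall>j<N. production_matrix a b \<phi> \<psi> i j = (\<Sum>s<m. exp_toeplitz \<psi> i s * ?Q s j)"
      by blast
  qed
qed

text \<open>Lower triangular Toeplitz matrices multiply like their power series. This supplies the
  product \<open>\<phi> * \<psi>\<close> needed for the coefficients of \<open>f\<close>
  itself.\<close>

lemma (in positive_semiring) totally_positive_in_toeplitz_mult:
  assumes "totally_positive_in S r (toeplitz g)" "totally_positive_in S r (toeplitz h)"
  shows "totally_positive_in S r (toeplitz (g * h))"
proof (rule totally_positive_in_mult[OF assms])
  fix N
  have "toeplitz (g * h) i j = (\<Sum>s<N. toeplitz g i s * toeplitz h s j)" if "i < N" for i j
  proof (cases "j \<le> i")
    case True
    have "(\<Sum>s<N. toeplitz g i s * toeplitz h s j) = (\<Sum>s\<in>{j..i}. g $ (i - s) * h $ (s - j))"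
      using that by (intro sum.mono_neutral_cong_right) (auto simp: toeplitz_def)
    also have "\<dots> = (\<Sum>s\<in>{0..i - j}. g $ s * h $ (i - j - s))"
      using True by (intro sum.reindex_bij_witness[of _ "\<lambda>s. i - s" "\<lambda>s. i - s"]) auto
    finally show ?thesis using True by (simp add: toeplitz_def fps_mult_nth)
  next
    case False
    then show ?thesis by (auto simp: toeplitz_def intro!: sum.neutral)
  qed
  then show "\<exists>m. \<forall>i<N. \<forall>j<N. toeplitz (g * h) i j = (\<Sum>s<m. toeplitz g i s * toeplitz h s j)"
    by blast
qed

lemma (in positive_semiring) totally_positive_in_toeplitz_1:
  "totally_positive_in S r (toeplitz 1)"
proof -
  have "toeplitz 1 = (\<lambda>i j. if j = i then 1 else if j = Suc i then 0 else 0 :: 'a)"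
    by (auto simp: toeplitz_def fun_eq_iff)
  then show ?thesis
    by (simp only:) (intro totally_positive_in_bidiagonal zero_closed one_closed)
qed

lemma fps_nth_mult_compose:
  fixes f g H :: "'a::idom fps"
  assumes f0: "f $ 0 = 0"
  shows "(g * (H oo f)) $ n = (\<Sum>j\<le>n. (g * f ^ j) $ n * H $ j)"
proof -
  \<comment> \<open>Since \<open>f\<close> has no constant term, \<open>f ^ j\<close> has order at
    least \<open>j\<close>, so the single cutoff \<open>n\<close> serves all coefficients up to
    \<open>n\<close>.\<close>
  have "(H oo f) $ m = (\<Sum>j\<le>n. H $ j * (f ^ j) $ m)" if "m \<le> n" for m
    unfolding fps_compose_nth using that startsby_zero_power_prefix[OF f0]
    by (intro sum.mono_neutral_left) auto
  then have "(g * (H oo f)) $ n = (\<Sum>i=0..n. g $ i * (\<Sum>j\<le>n. H $ j * (f ^ j) $ (n - i)))"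
    by (simp add: fps_mult_nth)
  also have "\<dots> = (\<Sum>j\<le>n. \<Sum>i=0..n. g $ i * (H $ j * (f ^ j) $ (n - i)))"
    unfolding sum_distrib_left by (rule sum.swap)
  also have "\<dots> = (\<Sum>j\<le>n. (g * f ^ j) $ n * H $ j)"
    by (simp add: fps_mult_nth sum_distrib_left mult_ac)
  finally show ?thesis .
qed

text \<open>The fundamental theorem of Riordan arrays in exponential form; both the production
  recurrence and the row polynomials are read off from it.\<close>

lemma egf_coeff_mult_compose:
  fixes f g H :: "'a::field_char_0 fps"
  assumes "f $ 0 = 0"
  shows "egf_coeff (g * (H oo f)) n = (\<Sum>j\<le>n. exp_riordan g f n j * egf_coeff H j)"
  unfolding egf_coeff_def fps_nth_mult_compose[OF assms] exp_riordan_def sum_distrib_left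
  by (rule sum.cong) auto

text \<open>Column \<open>k\<close> has exponential generating function
  \<open>(F * ?E) oo f\<close>. The chain rule brings in the derivative of \<open>f\<close>; its
  factor \<open>\<phi> oo f\<close> together with the exponential restores \<open>G\<close>, and
  what is left is the generating function of column \<open>k\<close> of the production matrix,
  composed with \<open>f\<close>.\<close>

lemma exp_riordan_production:
  fixes f \<phi> \<psi> :: "'a::field_char_0 fps" and a b :: 'a
  assumes f0: "f $ 0 = 0" and f': "fps_deriv f = (\<phi> * \<psi>) oo f" and a: "a \<noteq> 0"
  defines "G \<equiv> (\<phi> oo f) * (fps_exp (b / a) oo f)"
  shows "a * exp_riordan G f (Suc n) k =
    (\<Sum>s\<le>n. exp_riordan G f n s * production_matrix a b \<phi> \<psi> s k)"
proof -
  define F where "F = fps_const (inverse (fact k)) * (\<phi> * fps_X ^ k)"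
  let ?H = "\<psi> * (fps_const a * fps_deriv F + fps_const b * F)"
  let ?E = "fps_exp (b / a)"
  have "fps_const (inverse (fact k)) * (G * f ^ k) = (F * ?E) oo f"
    using f0 by (simp add: G_def F_def fps_compose_mult_distrib fps_compose_power[symmetric] mult_ac)
  then have *: "fps_const a * fps_deriv (fps_const (inverse (fact k)) * (G * f ^ k))
      = (fps_const a * fps_deriv (F * ?E) oo f) * ((\<phi> * \<psi>) oo f)"
    by (simp add: fps_compose_deriv[OF f0] f' fps_const_mult_apply_left[symmetric] mult.assoc
        del: fps_deriv_mult)
  \<comment> \<open>The exponent is \<open>b / a\<close> so that differentiating the exponential
    contributes exactly \<open>b\<close> after scaling by \<open>a\<close>.\<close>
  have "fps_const a * fps_deriv (F * ?E) = (fps_const a * fps_deriv F + fps_const b * F) * ?E"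
  proof -
    have "fps_const a * fps_deriv (F * ?E)
        = (fps_const a * fps_deriv F + (fps_const a * fps_const (b / a)) * F) * ?E"
      by (simp add: algebra_simps del: fps_const_mult)
    then show ?thesis using a by simp
  qed
  moreover have "G * (?H oo f) = ((fps_const a * fps_deriv F + fps_const b * F) * ?E oo f) * ((\<phi> * \<psi>) oo f)"
    by (simp add: G_def fps_compose_mult_distrib[OF f0] mult_ac)
  ultimately have eq: "G * (?H oo f) = fps_const a * fps_deriv (fps_const (inverse (fact k)) * (G * f ^ k))"
    using * by simp
  have "fact n * (fps_const a * fps_deriv (fps_const (inverse (fact k)) * W)) $ n
      = a * (fact (Suc n) / fact k * W $ Suc n)" for W :: "'a fps"
    by (simp add: divide_inverse mult_ac)
  then have "egf_coeff (G * (?H oo f)) n = a * exp_riordan G f (Suc n) k"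
    unfolding egf_coeff_def exp_riordan_def eq .
  then show ?thesis
    by (simp add: egf_coeff_mult_compose[OF f0] production_matrix_def Let_def F_def)
qed

text \<open>The powers of \<open>a\<close> absorb the factor \<open>a\<close> of the recurrence, so
  the array is generated by a matrix without division by \<open>a\<close>, although \<open>G\<close>
  involves \<open>b / a\<close>.\<close>

lemma (in positive_semiring) totally_positive_in_exp_riordan:
  fixes f \<phi> \<psi> :: "'a fps"
  assumes \<phi>: "totally_positive_in S r (toeplitz \<phi>)" and \<psi>: "totally_positive_in S r (toeplitz \<psi>)"
    and r: "r \<ge> 1" and ab: "a \<in> S" "b \<in> S" and a: "a \<noteq> 0"
    and f0: "f $ 0 = 0" and f': "fps_deriv f = (\<phi> * \<psi>) oo f"
  defines "G \<equiv> (\<phi> oo f) * (fps_exp (b / a) oo f)"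
  shows "totally_positive_in S r (\<lambda>n k. a ^ n * exp_riordan G f n k)"
    and "totally_positive_in S r (\<lambda>i j. a ^ (i + j) * egf_coeff G (i + j))"
proof -
  let ?U = "\<lambda>n k. a ^ n * exp_riordan G f n k"
  \<comment> \<open>The constant term is a minor of size 1, which is why \<open>r \<ge> 1\<close> is
    assumed.\<close>
  have c: "\<phi> $ 0 \<in> S"
    using totally_positive_in_entry[OF \<phi> r, of 0 0] by (simp add: toeplitz_def)
  have U0: "?U 0 j = (if j = 0 then \<phi> $ 0 else 0)" for j
    using f0 by (cases j) (simp_all add: exp_riordan_def G_def)
  have rec: "?U (Suc n) j = (\<Sum>s\<le>n. ?U n s * production_matrix a b \<phi> \<psi> s j)" for n j
    using exp_riordan_production[OF f0 f' a, of b n j]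
    by (simp add: G_def mult.assoc flip: sum_distrib_left)
  note tp = hankel_totally_positive_in_output[where U = ?U and c = "\<phi> $ 0",
      OF totally_positive_in_production_matrix[OF \<phi> \<psi> ab] c production_matrix_eq_0 U0 rec]
  show "totally_positive_in S r ?U" by (rule tp(1))
  have "?U n 0 = a ^ n * egf_coeff G n" for n
    by (simp add: exp_riordan_def egf_coeff_def)
  then show "totally_positive_in S r (\<lambda>i j. a ^ (i + j) * egf_coeff G (i + j))"
    using tp(2) by (simp only:)
qed

text \<open>Differentiate \<open>fps_inv f oo f = fps_X\<close> by the chain rule, then move the
  reciprocal inside the composition.\<close>

lemma fps_deriv_eq_compose_inverse_deriv_inv:
  fixes f :: "'a::field_char_0 fps"
  assumes "f $ 0 = 0" "f $ 1 \<noteq> 0"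
  shows "fps_deriv f = inverse (fps_deriv (fps_inv f)) oo f"
proof -
  let ?d = "fps_deriv (fps_inv f) oo f"
  have "?d * fps_deriv f = 1"
    using fps_compose_deriv[OF assms(1), of "fps_inv f"] fps_inv[OF assms] by simp
  moreover from this have d0: "?d $ 0 \<noteq> 0"
    by (metis fps_mult_nth_0 fps_one_nth mult_zero_left zero_neq_one)
  ultimately have "fps_deriv f = inverse ?d"
    by (metis fps_inverse_unique mult.commute)
  also have "\<dots> = inverse (fps_deriv (fps_inv f)) oo f"
    using d0 by (subst fps_inverse_compose[OF assms(1)]) (auto simp: fps_compose_nth)
  finally show ?thesis .
qed

text \<open>The exponential coefficients of \<open>fps_exp z\<close> are the powers of
  \<open>z\<close>. Thus evaluating a row polynomial multiplies \<open>g\<close> by one more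
  exponential in \<open>f\<close>.\<close>

lemma row_poly_exp_riordan:
  fixes f g :: "'a::field_char_0 fps"
  assumes "f $ 0 = 0"
  shows "row_poly (exp_riordan g f) n z = egf_coeff (g * (fps_exp z oo f)) n"
  unfolding row_poly_def egf_coeff_mult_compose[OF assms]
  by (rule sum.cong) (auto simp: egf_coeff_def fps_exp_def)

subsection \<open>Polynomials with nonnegative coefficients\<close>

lemma Sum_any_nonneg:
  fixes u :: "'a \<Rightarrow> 'b::ordered_comm_monoid_add"
  shows "(\<And>x. u x \<ge> 0) \<Longrightarrow> Sum_any u \<ge> 0"
  by (simp add: Sum_any.expand_set sum_nonneg)

lemma nonneg_polysI:
  "(\<And>m. m \<in> Poly_Mapping.keys p \<Longrightarrow> Poly_Mapping.keys m \<subseteq> X)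
    \<Longrightarrow> (\<And>m. Poly_Mapping.lookup p m \<ge> 0) \<Longrightarrow> to_fract p \<in> nonneg_polys X"
  by (auto simp: nonneg_polys_def)

lemma nonneg_polysE:
  assumes "x \<in> nonneg_polys X"
  obtains p where "x = to_fract p" "\<And>m. m \<in> Poly_Mapping.keys p \<Longrightarrow> Poly_Mapping.keys m \<subseteq> X"
    "\<And>m. Poly_Mapping.lookup p m \<ge> 0"
  using assms by (auto simp: nonneg_polys_def)

lemma nonneg_polys_mono: "X \<subseteq> Y \<Longrightarrow> nonneg_polys X \<subseteq> nonneg_polys Y"
  by (fastforce simp: nonneg_polys_def)

lemma to_fract_of_nat: "to_fract (of_nat n) = of_nat n"
  by (induction n) simp_all

interpretation nonneg_polys: positive_semiring "nonneg_polys (X :: 'v::linorder set)"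
proof
  have const: "to_fract (Poly_Mapping.single 0 c) \<in> nonneg_polys X" if "c \<ge> 0" for c
    using that by (intro nonneg_polysI) (auto simp: lookup_single when_def split: if_splits)
  show "0 \<in> nonneg_polys X" using const[of 0] by simp
  show "1 \<in> nonneg_polys X" using const[of 1] by simp
  show "inverse (of_nat n) \<in> nonneg_polys X" for n
  proof (cases "n = 0")
    case True
    then show ?thesis using const[of 0] by simp
  next
    case False
    \<comment> \<open>As the coefficients are real, the reciprocal of \<open>n\<close> is again a
      constant polynomial.\<close>
    have "to_fract (Poly_Mapping.single 0 (1 / real n)) * (of_nat n :: 'v ratfun)
        = to_fract (Poly_Mapping.single 0 (1 / real n) * Poly_Mapping.single 0 (real n))"
      by (simp flip: to_fract_of_nat single_of_nat)
    also have "\<dots> = 1" using False by (simp add: mult_single del: to_fract_mult single_of_nat)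
    finally have "inverse (of_nat n :: 'v ratfun) = to_fract (Poly_Mapping.single 0 (1 / real n))"
      using inverse_unique by (metis mult.commute)
    then show ?thesis using const by simp
  qed
next
  fix x y :: "'v ratfun" assume xy: "x \<in> nonneg_polys X" "y \<in> nonneg_polys X"
  obtain p where p: "x = to_fract p" "\<And>m. m \<in> Poly_Mapping.keys p \<Longrightarrow> Poly_Mapping.keys m \<subseteq> X"
    "\<And>m. Poly_Mapping.lookup p m \<ge> 0" using xy(1) by (rule nonneg_polysE) blast
  obtain q where q: "y = to_fract q" "\<And>m. m \<in> Poly_Mapping.keys q \<Longrightarrow> Poly_Mapping.keys m \<subseteq> X"
    "\<And>m. Poly_Mapping.lookup q m \<ge> 0" using xy(2) by (rule nonneg_polysE) blast
  have "to_fract (p + q) \<in> nonneg_polys X"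
  proof (rule nonneg_polysI)
    show "Poly_Mapping.keys m \<subseteq> X" if "m \<in> Poly_Mapping.keys (p + q)" for m
      using that keys_add[of p q] p(2) q(2) by blast
  qed (simp add: lookup_add p q)
  then show "x + y \<in> nonneg_polys X" by (simp add: p q)
  have "to_fract (p * q) \<in> nonneg_polys X"
  proof (rule nonneg_polysI)
    fix m assume "m \<in> Poly_Mapping.keys (p * q)"
    then obtain a b where "m = a + b" "a \<in> Poly_Mapping.keys p" "b \<in> Poly_Mapping.keys q"
      using keys_mult[of p q] by blast
    then show "Poly_Mapping.keys m \<subseteq> X"
      using keys_add[of a b] p(2)[of a] q(2)[of b] by blast
  qed (auto simp: lookup_mult p q when_def intro!: Sum_any_nonneg mult_nonneg_nonneg)
  then show "x * y \<in> nonneg_polys X" by (simp add: p q)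
qed

lemma indet_nonneg_polys: "v \<in> X \<Longrightarrow> indet v \<in> nonneg_polys X"
  unfolding indet_def by (rule nonneg_polysI) (auto simp: lookup_single when_def)

lemma indet_nonzero: "indet v \<noteq> 0"
  unfolding indet_def to_fract_eq_0_iff
  by (metis keys_single keys_zero insert_not_empty zero_neq_one)

lemma cw_totally_positive_iff:
  "cw_totally_positive X r M \<longleftrightarrow> totally_positive_in (nonneg_polys X) r M"
  by (simp add: cw_totally_positive_def totally_positive_in_def minor_def)

theorem theorem5p3:
  fixes X :: "'v::linorder set" and l q :: 'v and r :: nat
    and f \<phi> \<psi> :: "'v ratfun fps"
  assumes "l \<notin> X" and "q \<notin> X" and "l \<noteq> q"
    and "r \<ge> 1"
    and "\<And>n. egf_coeff f n \<in> polys X"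
    and "fps_nth f 0 = 0" and "fps_nth f 1 \<noteq> 0"
    and "inverse (fps_deriv (fps_inv f)) = \<phi> * \<psi>"
    and "polya_frequency X r \<phi>" and "polya_frequency X r \<psi>"
  defines "g \<equiv> \<lambda>z. fps_compose \<phi> f * fps_compose (fps_exp z) f"
  defines "R \<equiv> exp_riordan (g (indet l)) f"
  defines "T \<equiv> \<lambda>n z. egf_coeff (g z) n"
  shows "cw_totally_positive (insert l X) r R \<and>
    cw_hankel_totally_positive (insert q (insert l X)) r (\<lambda>n. row_poly R n (indet q)) \<and>
    cw_hankel_totally_positive (insert q (insert l X)) r
      (\<lambda>n. reversed (row_poly R) n (indet q)) \<and>
    cw_hankel_totally_positive (insert l X) r (\<lambda>n. T n (indet l)) \<and>
    cw_hankel_totally_positive (insert l X) r (\<lambda>n. reversed T n (indet l)) \<and>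
    cw_hankel_totally_positive X r (\<lambda>n. egf_coeff f (n + 1))"
proof -
  note r = assms(4) and f0 = assms(6)
  let ?L = "insert l X" and ?Q = "insert q (insert l X)"
  have f': "fps_deriv f = (\<phi> * \<psi>) oo f"
    using fps_deriv_eq_compose_inverse_deriv_inv[OF assms(6,7)] assms(8) by simp
  \<comment> \<open>Positivity over \<open>X\<close> persists when the indeterminates
    \<open>l\<close> and \<open>q\<close> are adjoined.\<close>
  have tp: "totally_positive_in (nonneg_polys Y) r (toeplitz \<phi>)"
    "totally_positive_in (nonneg_polys Y) r (toeplitz \<psi>)" if "X \<subseteq> Y" for Y
    using assms(9,10) totally_positive_in_mono[OF _ nonneg_polys_mono[OF that]]
    by (auto simp: polya_frequency_def cw_totally_positive_iff)
  have hankel: "cw_hankel_totally_positive Y r (\<lambda>n. a ^ n * T n (b / a))"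
    if "X \<subseteq> Y" "a \<in> nonneg_polys Y" "b \<in> nonneg_polys Y" "a \<noteq> 0" for Y a b
    using nonneg_polys.totally_positive_in_exp_riordan(2)[OF tp[OF that(1)] r that(2-4) f0 f']
    by (simp add: cw_hankel_totally_positive_def cw_totally_positive_iff T_def g_def)
  have row: "row_poly R n z = T n (indet l + z)" for n z
    by (simp add: R_def T_def g_def row_poly_exp_riordan[OF f0] fps_exp_add_mult
        fps_compose_mult_distrib[OF f0] mult.assoc)
  note closed = nonneg_polys.one_closed nonneg_polys.zero_closed
    nonneg_polys.add_closed nonneg_polys.mult_closed indet_nonneg_polys

  have "totally_positive_in (nonneg_polys ?L) r R"
    using nonneg_polys.totally_positive_in_exp_riordan(1)[where a = 1 and b = "indet l",
        OF tp[of ?L] r _ _ _ f0 f']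
    by (auto simp: R_def g_def intro: closed)
  moreover have "cw_hankel_totally_positive ?Q r (\<lambda>n. row_poly R n (indet q))"
    using hankel[of ?Q 1 "indet l + indet q"] by (auto simp: row intro: closed)
  moreover have "cw_hankel_totally_positive ?Q r (\<lambda>n. reversed (row_poly R) n (indet q))"
  proof -
    \<comment> \<open>Reversal evaluates the row polynomial at \<open>1 / q\<close>, so the argument
      of \<open>T\<close> is \<open>l + 1 / q\<close>; taking \<open>a = q\<close> clears its
      denominator.\<close>
    have "(indet q * indet l + 1) / indet q = indet l + 1 / indet q"
      using indet_nonzero[of q] by (simp add: field_simps)
    then show ?thesis
      using hankel[of ?Q "indet q" "indet q * indet l + 1"]
      by (auto simp: row reversed_def indet_nonzero intro: closed)
  qed
  moreover have "cw_hankel_totally_positive ?L r (\<lambda>n. T n (indet l))"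
    using hankel[of ?L 1 "indet l"] by (auto intro: closed)
  moreover have "cw_hankel_totally_positive ?L r (\<lambda>n. reversed T n (indet l))"
    using hankel[of ?L "indet l" 1] by (auto simp: reversed_def indet_nonzero intro: closed)
  moreover have "cw_hankel_totally_positive X r (\<lambda>n. egf_coeff f (n + 1))"
  proof -
    have "egf_coeff f (n + 1) = egf_coeff (fps_deriv f) n" for n
      by (simp add: egf_coeff_def mult_ac)
    \<comment> \<open>The exponential is trivial here, so \<open>G\<close> is the derivative of
      \<open>f\<close>; \<open>1 ^ (i + j)\<close> and \<open>0 / 1\<close> are written out to match
      the general lemma at \<open>a = 1\<close>, \<open>b = 0\<close>.\<close>
    moreover have "totally_positive_in (nonneg_polys X) r
        (\<lambda>i j. 1 ^ (i + j) * egf_coeff (((\<phi> * \<psi>) oo f) * (fps_exp (0 / 1) oo f)) (i + j))"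
      using f'
      by (intro nonneg_polys.totally_positive_in_exp_riordan(2)[where \<psi> = 1]
          nonneg_polys.totally_positive_in_toeplitz_mult tp nonneg_polys.totally_positive_in_toeplitz_1
          r f0 closed) auto
    ultimately show ?thesis
      by (simp add: cw_hankel_totally_positive_def cw_totally_positive_iff f')
  qed
  ultimately show ?thesis by (simp add: cw_totally_positive_iff)
qed

end
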